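(* Let $G=(V,E)$ be a locally finite simple graph and let $\mathcal K_{G,x}:(0,\infty]\to\mathbb R$ be the curvature function of $x\in V$. Then $$av_1^+(x)=3+d_x-2\lim_{\mathcal N\to0}\left(\mathcal K_{G,x}(\mathcal N)+\frac{2d_x}{\mathcal N}\right).$$
   Context: Graphs are undirected, without loops or multiple edges, and every vertex has finite degree; $d_x$ is the degree of $x$, and the vertex $x$ considered has $d_x\ge1$. For $f:V\to\mathbb R$ put $\Delta f(x)=\sum_{y\sim x}(f(y)-f(x))$ (non-normalized Laplacian), and for $f,g:V\to\mathbb R$ put $2\Gamma(f,g)=\Delta(fg)-f\Delta g-g\Delta f$, $2\Gamma_2(f,g)=\Delta\Gamma(f,g)-\Gamma(f,\Delta g)-\Gamma(\Delta f,g)$, $\Gamma(f)=\Gamma(f,f)$, $\Gamma_2(f)=\Gamma_2(f,f)$. For $\mathcal N\in(0,\infty]$ (convention $1/\infty=0$), $\mathcal K_{G,x}(\mathcal N)$ is the largest $K\in\mathbb R$ such that $\Gamma_2(f)(x)\ge\frac1{\mathcal N}(\Delta f(x))^2+K\,\Gamma(f)(x)$ for all $f:V\to\mathbb R$ (Bakry-Émery curvature function). $S_1(x)$ is the set of neighbours of $x$. For $y\in S_1(x)$, the out degree $d_y^+$ is the number of neighbours of $y$ at graph distance $2$ from $x$; $av_1^+(x)=\frac1{d_x}\sum_{y\in S_1(x)}d_y^+$. *)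

theory Defs
  imports Complex_Main "HOL-Library.Extended_Real"
begin

text \<open>
  A graph is given by a vertex set \<open>V\<close> and a set \<open>E\<close> of unordered pairs of distinct vertices.
\<close>

definition neighbours :: "'a set set \<Rightarrow> 'a \<Rightarrow> 'a set" where
  "neighbours E x = {y. {x, y} \<in> E}"

locale locally_finite_simple_graph =
  fixes V :: "'a set" and E :: "'a set set"
  assumes edges: "e \<in> E \<Longrightarrow> e \<subseteq> V \<and> card e = 2"
    and locally_finite: "v \<in> V \<Longrightarrow> finite (neighbours E v)"

definition vertex_degree :: "'a set set \<Rightarrow> 'a \<Rightarrow> nat" where
  "vertex_degree E x = card (neighbours E x)"

text \<open>Least length of a walk; the infimum of the empty set is \<open>\<infinity>\<close> (different components).\<close>

definition graph_dist :: "'a set set \<Rightarrow> 'a \<Rightarrow> 'a \<Rightarrow> enat" where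
  "graph_dist E x y = Inf {enat n | n. (x, y) \<in> {(u, v). {u, v} \<in> E} ^^ n}"

text \<open>
  Functions \<open>V \<rightarrow> \<real>\<close> are represented by total functions on the vertex type: at a vertex of a graph,
  the operators below only use values at vertices of the graph.
\<close>

definition laplacian :: "'a set set \<Rightarrow> ('a \<Rightarrow> real) \<Rightarrow> 'a \<Rightarrow> real" where
  "laplacian E f x = (\<Sum>y\<in>neighbours E x. f y - f x)"

definition Gamma_op :: "'a set set \<Rightarrow> ('a \<Rightarrow> real) \<Rightarrow> ('a \<Rightarrow> real) \<Rightarrow> 'a \<Rightarrow> real" where
  "Gamma_op E f g x =
    (laplacian E (\<lambda>y. f y * g y) x - f x * laplacian E g x - g x * laplacian E f x) / 2"

definition Gamma2_op :: "'a set set \<Rightarrow> ('a \<Rightarrow> real) \<Rightarrow> ('a \<Rightarrow> real) \<Rightarrow> 'a \<Rightarrow> real" where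
  "Gamma2_op E f g x =
    (laplacian E (Gamma_op E f g) x - Gamma_op E f (laplacian E g) x - Gamma_op E (laplacian E f) g x) / 2"

definition curvature_dimension_ineq :: "'a set set \<Rightarrow> 'a \<Rightarrow> real \<Rightarrow> ereal \<Rightarrow> bool" where
  "curvature_dimension_ineq E x K N \<longleftrightarrow>
    (\<forall>f :: 'a \<Rightarrow> real.
      Gamma2_op E f f x \<ge> real_of_ereal (1 / N) * (laplacian E f x)\<^sup>2 + K * Gamma_op E f f x)"

text \<open>Only meaningful for \<open>0 < N \<le> \<infinity>\<close>; note that \<open>1 / \<infinity> = 0\<close> in \<^typ>\<open>ereal\<close>.\<close>

definition curvature_function :: "'a set set \<Rightarrow> 'a \<Rightarrow> ereal \<Rightarrow> real" where
  "curvature_function E x N = (GREATEST K. curvature_dimension_ineq E x K N)"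

definition out_degree :: "'a set set \<Rightarrow> 'a \<Rightarrow> 'a \<Rightarrow> nat" where
  "out_degree E x y = card {z \<in> neighbours E y. graph_dist E x z = 2}"

definition av_out_degree :: "'a set set \<Rightarrow> 'a \<Rightarrow> real" where
  "av_out_degree E x = 1 / real (vertex_degree E x) * (\<Sum>y\<in>neighbours E x. real (out_degree E x y))"

end

theory Submission imports Defs "HOL-Analysis.Elementary_Metric_Spaces" begin

text \<open>
  Put \<open>F = f - f x\<close> and \<open>a y = (3 - d\<^sub>y\<^sup>+ - d\<^sub>x) / 2\<close>. Then \<open>2 \<Gamma>\<^sub>2(f)(x)\<close> equals
  \<open>(\<Sum>y\<sim>x. a y * F y\<^sup>2) + (\<Delta>f x)\<^sup>2\<close> plus a sum of squares which vanishes when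
  \<open>F\<close> is the distance from \<open>x\<close>. That test function gives
  \<open>\<K>(N) + 2 d\<^sub>x / N \<le> mean a + d\<^sub>x\<close>. Conversely, dropping the squares leaves
  a diagonal form plus \<open>1 / 2 - 1 / N\<close> times a rank-one form; by Cauchy-Schwarz it dominates
  \<open>K \<Gamma>(f)(x)\<close> as soon as \<open>(2 / N - 1) * (\<Sum>y\<sim>x. 1 / (a y - K)) \<le> 1\<close>, and expanding
  this sum for \<open>K = mean a + d\<^sub>x - 2 d\<^sub>x / N - \<epsilon>\<close> shows that it holds for all small \<open>N\<close>.
\<close>

section \<open>The Gamma calculus and the structure of the 2-ball\<close>

lemma Gamma_op_eq: "Gamma_op E f g x = (\<Sum>y\<in>neighbours E x. (f y - f x) * (g y - g x)) / 2"
  unfolding Gamma_op_def laplacian_def sum_distrib_left sum_subtractf[symmetric]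
  by (simp add: algebra_simps)

text \<open>By symmetry of \<open>Gamma_op\<close> the two mixed terms agree, so everything collects
  into one sum over the neighbours of \<open>x\<close>.\<close>

lemma Gamma2_op_eq:
  "2 * Gamma2_op E f f x =
    (\<Sum>y\<in>neighbours E x. Gamma_op E f f y - Gamma_op E f f x
        - (f y - f x) * (laplacian E f y - laplacian E f x))"
  by (simp add: Gamma2_op_def Gamma_op_eq[where f = f and g = "laplacian E f"]
      Gamma_op_eq[where f = "laplacian E f" and g = f] mult.commute
      laplacian_def[of E "Gamma_op E f f"] sum_subtractf)

lemma neighbours_sym: "y \<in> neighbours E x \<longleftrightarrow> x \<in> neighbours E y"
  by (simp add: neighbours_def insert_commute)

lemma (in locally_finite_simple_graph) not_neighbours_self: "x \<notin> neighbours E x"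
  using edges[of "{x, x}"] by (auto simp: neighbours_def)

text \<open>Points of the type outside \<open>V\<close> lie on no edge, so local finiteness on
  \<open>V\<close> extends to every \<open>x\<close>.\<close>

lemma (in locally_finite_simple_graph) finite_neighbours: "finite (neighbours E x)"
proof (cases "neighbours E x = {}")
  case False
  then obtain y where "{x, y} \<in> E" by (auto simp: neighbours_def)
  then show ?thesis using edges[of "{x, y}"] locally_finite by auto
qed simp

text \<open>The walk through \<open>y\<close> bounds the distance by 2; lengths 0 and 1 are exactly
  what the right-hand side excludes.\<close>

lemma (in locally_finite_simple_graph) graph_dist_eq_2_iff:
  assumes y: "y \<in> neighbours E x" and z: "z \<in> neighbours E y"
  shows "graph_dist E x z = 2 \<longleftrightarrow> z \<noteq> x \<and> z \<notin> neighbours E x"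
proof -
  let ?R = "{(u, v). {u, v} \<in> E}"
  let ?A = "{enat n | n. (x, z) \<in> ?R ^^ n}"
  have "(x, z) \<in> ?R ^^ 2"
    using y z by (auto simp: neighbours_def numeral_2_eq_2 relcomp_unfold)
  then have mem: "2 \<in> ?A" by (auto simp: numeral_eq_enat)
  show ?thesis
  proof
    assume dist: "graph_dist E x z = 2"
    have lower: "2 \<le> n" if "(x, z) \<in> ?R ^^ n" for n
    proof -
      have "graph_dist E x z \<le> enat n"
        unfolding graph_dist_def using that by (intro Inf_lower) auto
      then show ?thesis by (simp add: dist numeral_eq_enat)
    qed
    show "z \<noteq> x \<and> z \<notin> neighbours E x"
      using lower[of 0] lower[of 1] by (auto simp: neighbours_def)
  next
    assume nz: "z \<noteq> x \<and> z \<notin> neighbours E x"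
    have "2 \<le> n" if "(x, z) \<in> ?R ^^ n" for n
    proof (rule ccontr)
      assume "\<not> 2 \<le> n"
      then have "n = 0 \<or> n = 1" by auto
      then show False using that nz by (auto simp: neighbours_def)
    qed
    then have "2 \<le> Inf ?A" by (intro Inf_greatest) (auto simp: numeral_eq_enat)
    with Inf_lower[OF mem] show "graph_dist E x z = 2" by (simp add: graph_dist_def)
  qed
qed

text \<open>Each neighbour \<open>z\<close> of \<open>y\<close> is \<open>x\<close>, a common
  neighbour, or at distance 2 from \<open>x\<close>; a square is completed in the last two cases.
  The term \<open>Gamma_op E f f x\<close>, subtracted once per neighbour of \<open>x\<close>, gives
  the degree in the coefficient.\<close>

lemma (in locally_finite_simple_graph) Gamma2_op_decomposition:
  fixes f :: "'a \<Rightarrow> real" and x :: 'a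
  defines "F \<equiv> \<lambda>y. f y - f x"
  shows "2 * Gamma2_op E f f x =
    (\<Sum>y\<in>neighbours E x. (3 - real (out_degree E x y) - real (vertex_degree E x)) / 2 * (F y)\<^sup>2)
    + (laplacian E f x)\<^sup>2
    + (\<Sum>y\<in>neighbours E x. \<Sum>z\<in>neighbours E y \<inter> neighbours E x. (F y - F z)\<^sup>2)
    + (\<Sum>y\<in>neighbours E x. \<Sum>z\<in>neighbours E y - insert x (neighbours E x). (F z - 2 * F y)\<^sup>2) / 2"
proof -
  let ?N = "neighbours E x"
  let ?M = "\<lambda>y. neighbours E y \<inter> ?N"
  let ?P = "\<lambda>y. neighbours E y - insert x ?N"
  note fin = finite_neighbours
  have lap: "laplacian E f x = sum F ?N" by (simp add: laplacian_def F_def)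
  have Gam: "Gamma_op E f f x = (\<Sum>y\<in>?N. (F y)\<^sup>2) / 2"
    by (simp add: Gamma_op_eq F_def power2_eq_square)
  have inner: "Gamma_op E f f y - (f y - f x) * laplacian E f y =
      (3 - real (out_degree E x y)) / 2 * (F y)\<^sup>2
      + (\<Sum>z\<in>?M y. (F y - F z)\<^sup>2) + (\<Sum>z\<in>?M y. ((F y)\<^sup>2 - (F z)\<^sup>2) / 2)
      + (\<Sum>z\<in>?P y. (F z - 2 * F y)\<^sup>2) / 2" (is "?lhs = _")
    if y: "y \<in> ?N" for y
  proof -
    \<comment> \<open>Contribution of the edge \<open>yz\<close> to the left-hand side, expanded in
      \<open>F\<close>.\<close>
    let ?h = "\<lambda>z. (F z)\<^sup>2 / 2 - 2 * F y * F z + 3 / 2 * (F y)\<^sup>2"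
    have "?lhs = (\<Sum>z\<in>neighbours E y. ?h z)"
      unfolding Gamma_op_eq laplacian_def sum_distrib_left sum_divide_distrib sum_subtractf[symmetric]
      by (rule sum.cong) (auto simp: F_def power2_eq_square field_simps)
    also have "neighbours E y = insert x (?M y \<union> ?P y)"
      using y neighbours_sym[of y E x] by auto
    also have "(\<Sum>z\<in>insert x (?M y \<union> ?P y). ?h z) = ?h x + (\<Sum>z\<in>?M y. ?h z) + (\<Sum>z\<in>?P y. ?h z)"
    proof -
      have "(\<Sum>z\<in>?M y \<union> ?P y. ?h z) = (\<Sum>z\<in>?M y. ?h z) + (\<Sum>z\<in>?P y. ?h z)"
        using fin by (intro sum.union_disjoint) auto
      then show ?thesis using fin not_neighbours_self by (subst sum.insert) auto
    qed
    also have "?h x = 3 / 2 * (F y)\<^sup>2" by (simp add: F_def)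
    \<comment> \<open>Splitting off the part antisymmetric in \<open>y\<close> and \<open>z\<close>
      leaves a perfect square.\<close>
    also have "(\<Sum>z\<in>?M y. ?h z) = (\<Sum>z\<in>?M y. (F y - F z)\<^sup>2) + (\<Sum>z\<in>?M y. ((F y)\<^sup>2 - (F z)\<^sup>2) / 2)"
      unfolding sum.distrib[symmetric]
      by (rule sum.cong) (auto simp: power2_eq_square field_simps)
    \<comment> \<open>Completing the square in \<open>F z\<close> costs half of \<open>F y\<close>
      squared per outward edge; this is how the out degree enters.\<close>
    also have "(\<Sum>z\<in>?P y. ?h z) = (\<Sum>z\<in>?P y. (F z - 2 * F y)\<^sup>2 / 2 - (F y)\<^sup>2 / 2)"
      by (rule sum.cong) (auto simp: power2_eq_square field_simps)
    also have "\<dots> = (\<Sum>z\<in>?P y. (F z - 2 * F y)\<^sup>2) / 2 - card (?P y) * ((F y)\<^sup>2 / 2)"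
      by (simp add: sum_subtractf sum_divide_distrib)
    also have "card (?P y) = out_degree E x y"
      using graph_dist_eq_2_iff[OF y] unfolding out_degree_def by (intro arg_cong[of _ _ card]) auto
    finally show ?thesis by (simp add: field_simps)
  qed
  \<comment> \<open>Every edge inside the sphere is counted in both orientations, with opposite
    signs.\<close>
  have antisym: "(\<Sum>y\<in>?N. \<Sum>z\<in>?M y. ((F y)\<^sup>2 - (F z)\<^sup>2) / 2) = 0" (is "?s = 0")
  proof -
    let ?g = "\<lambda>y z. if z \<in> neighbours E y then ((F y)\<^sup>2 - (F z)\<^sup>2) / 2 else 0"
    have s: "?s = (\<Sum>y\<in>?N. \<Sum>z\<in>?N. ?g y z)"
      unfolding Int_commute[of _ ?N] sum.inter_restrict[OF fin] ..
    also have "\<dots> = (\<Sum>y\<in>?N. \<Sum>z\<in>?N. ?g z y)" by (rule sum.swap)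
    also have "\<dots> = (\<Sum>y\<in>?N. \<Sum>z\<in>?N. - ?g y z)"
      by (intro sum.cong refl) (auto simp: neighbours_sym[of _ E] field_simps)
    also have "\<dots> = - ?s" by (simp add: s sum_negf)
    finally show ?thesis by simp
  qed
  have "2 * Gamma2_op E f f x = (\<Sum>y\<in>?N. (Gamma_op E f f y - (f y - f x) * laplacian E f y)
      + F y * laplacian E f x - Gamma_op E f f x)"
    unfolding Gamma2_op_eq by (rule sum.cong) (auto simp: F_def algebra_simps)
  also have "\<dots> = (\<Sum>y\<in>?N. Gamma_op E f f y - (f y - f x) * laplacian E f y)
      + (laplacian E f x)\<^sup>2 - real (vertex_degree E x) * ((\<Sum>y\<in>?N. (F y)\<^sup>2) / 2)"
    by (simp only: sum.distrib sum_subtractf lap Gam vertex_degree_def power2_eq_square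
        sum_distrib_right[symmetric] sum_constant)
  also have "(\<Sum>y\<in>?N. Gamma_op E f f y - (f y - f x) * laplacian E f y) =
      (\<Sum>y\<in>?N. (3 - real (out_degree E x y)) / 2 * (F y)\<^sup>2)
      + (\<Sum>y\<in>?N. \<Sum>z\<in>?M y. (F y - F z)\<^sup>2)
      + (\<Sum>y\<in>?N. \<Sum>z\<in>?P y. (F z - 2 * F y)\<^sup>2) / 2"
    using antisym by (simp add: inner sum.distrib sum_divide_distrib cong: sum.cong)
  finally show ?thesis
    by (simp add: diff_divide_distrib left_diff_distrib sum_subtractf sum_distrib_left sum_divide_distrib)
qed

section \<open>Curvature bounds from below and above\<close>

lemma weighted_Cauchy_Schwarz:
  fixes w u :: "'a \<Rightarrow> real"
  assumes "\<And>i. i \<in> A \<Longrightarrow> w i > 0"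
  shows "(sum u A)\<^sup>2 \<le> (\<Sum>i\<in>A. 1 / w i) * (\<Sum>i\<in>A. w i * (u i)\<^sup>2)"
proof (cases "finite A \<and> A \<noteq> {}")
  case True
  define W where "W = (\<Sum>i\<in>A. 1 / w i)"
  define S where "S = sum u A"
  have W: "W > 0" unfolding W_def using True assms by (intro sum_pos) auto
  \<comment> \<open>\<open>S / (W * w i)\<close> minimises the weighted square sum among all
    \<open>u\<close> with sum \<open>S\<close>; expanding the deviation from it yields the
    claim.\<close>
  have "0 \<le> (\<Sum>i\<in>A. w i * (u i - S / (W * w i))\<^sup>2)"
    using assms by (intro sum_nonneg mult_nonneg_nonneg) (auto intro: less_imp_le)
  also have "\<dots> = (\<Sum>i\<in>A. w i * (u i)\<^sup>2 - (2 * S / W) * u i + (S\<^sup>2 / W\<^sup>2) * (1 / w i))"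
  proof (rule sum.cong)
    fix i assume "i \<in> A"
    then have "w i > 0" by (rule assms)
    then show "w i * (u i - S / (W * w i))\<^sup>2
        = w i * (u i)\<^sup>2 - (2 * S / W) * u i + (S\<^sup>2 / W\<^sup>2) * (1 / w i)"
      using W by (simp add: power2_eq_square field_simps)
  qed simp
  also have "\<dots> = (\<Sum>i\<in>A. w i * (u i)\<^sup>2) - (2 * S / W) * S + (S\<^sup>2 / W\<^sup>2) * W"
    by (simp only: sum.distrib sum_subtractf sum_distrib_left[symmetric] S_def W_def)
  also have "\<dots> = (\<Sum>i\<in>A. w i * (u i)\<^sup>2) - S\<^sup>2 / W"
    using W by (simp add: power2_eq_square field_simps)
  finally show ?thesis using W by (simp add: S_def W_def field_simps)
qed auto

lemma real_of_ereal_inverse: "N > 0 \<Longrightarrow> real_of_ereal (1 / ereal N) = 1 / N"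
  by (simp add: one_ereal_def)

lemma (in locally_finite_simple_graph) curvature_dimension_ineq_if:
  fixes x :: 'a
  defines "a \<equiv> \<lambda>y. (3 - real (out_degree E x y) - real (vertex_degree E x)) / 2"
  assumes N: "0 < N" "N \<le> 2"
    and K: "\<And>y. y \<in> neighbours E x \<Longrightarrow> K < a y"
    and le: "(2 / N - 1) * (\<Sum>y\<in>neighbours E x. 1 / (a y - K)) \<le> 1"
  shows "curvature_dimension_ineq E x K (ereal N)"
  unfolding curvature_dimension_ineq_def
proof
  fix f :: "'a \<Rightarrow> real"
  define F where "F = (\<lambda>y. f y - f x)"
  let ?N = "neighbours E x"
  define S where "S = laplacian E f x"
  define Q where "Q = (\<Sum>y\<in>?N. (a y - K) * (F y)\<^sup>2)"
  have S: "S = sum F ?N" by (simp add: S_def laplacian_def F_def)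
  have Q: "Q \<ge> 0" unfolding Q_def using K by (intro sum_nonneg mult_nonneg_nonneg) (auto intro: less_imp_le)
  have Gam: "Gamma_op E f f x = (\<Sum>y\<in>?N. (F y)\<^sup>2) / 2"
    by (simp add: Gamma_op_eq F_def power2_eq_square)
  have "(\<Sum>y\<in>?N. a y * (F y)\<^sup>2) + S\<^sup>2 \<le> 2 * Gamma2_op E f f x"
    unfolding Gamma2_op_decomposition a_def F_def S_def
    by (simp add: sum_nonneg)
  then have G2: "Q + 2 * K * Gamma_op E f f x + S\<^sup>2 \<le> 2 * Gamma2_op E f f x"
    by (simp add: Q_def Gam left_diff_distrib sum_subtractf mult.assoc sum_distrib_left[symmetric])
  \<comment> \<open>Cauchy-Schwarz with weights \<open>a y - K\<close>; the factor in front is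
    nonnegative because \<open>N\<close> is at most 2.\<close>
  have "(2 / N - 1) * S\<^sup>2 \<le> (2 / N - 1) * ((\<Sum>y\<in>?N. 1 / (a y - K)) * Q)"
    unfolding S Q_def using N K by (intro mult_left_mono weighted_Cauchy_Schwarz) auto
  also have "\<dots> \<le> 1 * Q"
    unfolding mult.assoc[symmetric] by (rule mult_right_mono[OF le Q])
  finally have "2 * (1 / N * S\<^sup>2) - S\<^sup>2 \<le> Q" by (simp add: field_simps)
  with G2 show "real_of_ereal (1 / ereal N) * (laplacian E f x)\<^sup>2 + K * Gamma_op E f f x
      \<le> Gamma2_op E f f x"
    unfolding real_of_ereal_inverse[OF N(1)] S_def[symmetric] by linarith
qed

lemma (in locally_finite_simple_graph) curvature_dimension_ineq_upper:
  assumes N: "0 < N" and d: "vertex_degree E x \<ge> 1"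
    and K: "curvature_dimension_ineq E x K (ereal N)"
  shows "K + 2 * real (vertex_degree E x) / N
    \<le> (3 + real (vertex_degree E x) - av_out_degree E x) / 2"
proof -
  define d where "d = real (vertex_degree E x)"
  have dpos: "d > 0" using assms(2) by (simp add: d_def)
  let ?N = "neighbours E x"
  \<comment> \<open>The distance from \<open>x\<close>, truncated at 2. Common neighbours have equal
    values and outer ones twice the value of \<open>y\<close>, so both sums of squares in the
    decomposition vanish.\<close>
  define f :: "'a \<Rightarrow> real" where "f v = (if v = x then 0 else if v \<in> ?N then 1 else 2)" for v
  have fx: "f x = 0" by (simp add: f_def)
  have f1: "f y = 1" if "y \<in> ?N" for y using that not_neighbours_self[of x] by (auto simp: f_def)
  have f2: "f z = 2" if "z \<notin> insert x ?N" for z using that by (auto simp: f_def)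
  have lap: "laplacian E f x = d" by (simp add: laplacian_def fx f1 d_def vertex_degree_def)
  have Gam: "Gamma_op E f f x = d / 2" by (simp add: Gamma_op_eq fx f1 d_def vertex_degree_def)
  have "2 * Gamma2_op E f f x = (\<Sum>y\<in>?N. (3 - real (out_degree E x y) - d) / 2) + d\<^sup>2"
    unfolding Gamma2_op_decomposition lap d_def[symmetric] by (simp add: fx f1 f2)
  also have "(\<Sum>y\<in>?N. (3 - real (out_degree E x y) - d) / 2)
      = (d * 3 - d * av_out_degree E x - d * d) / 2"
    using dpos by (simp add: sum_divide_distrib[symmetric] sum_subtractf av_out_degree_def
        d_def vertex_degree_def)
  finally have G2: "2 * Gamma2_op E f f x = (d * 3 - d * av_out_degree E x - d * d) / 2 + d\<^sup>2" .
  have "1 / N * d\<^sup>2 + K * (d / 2) \<le> Gamma2_op E f f x"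
    using K[unfolded curvature_dimension_ineq_def, rule_format, of f]
    unfolding real_of_ereal_inverse[OF N] lap Gam .
  then have "d * (K + 2 * d / N) \<le> d * ((3 + d - av_out_degree E x) / 2)"
    using G2 by (simp add: power2_eq_square field_simps)
  then show ?thesis using dpos by (simp add: d_def)
qed

section \<open>Attainment of the optimal curvature and the limit\<close>

text \<open>\<open>GREATEST\<close> is informative only if a maximum exists. For each
  \<open>f\<close> the condition on \<open>K\<close> is a non-strict inequality between continuous
  functions, so the admissible set is closed; being nonempty and bounded above, it contains its
  supremum.\<close>

lemma curvature_function_greatest:
  assumes mem: "curvature_dimension_ineq E x K\<^sub>0 N"
    and bdd: "\<And>K. curvature_dimension_ineq E x K N \<Longrightarrow> K \<le> B"
  shows "curvature_dimension_ineq E x (curvature_function E x N) N"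
    and "K\<^sub>0 \<le> curvature_function E x N"
proof -
  let ?A = "{K. curvature_dimension_ineq E x K N}"
  have "closed ?A"
    unfolding curvature_dimension_ineq_def
    by (intro closed_Collect_all closed_Collect_le continuous_intros)
  moreover have bdd': "bdd_above ?A" by (rule bdd_aboveI[where M = B]) (simp add: bdd)
  moreover have "?A \<noteq> {}" using mem by auto
  ultimately have Sup: "Sup ?A \<in> ?A" by (intro closed_contains_Sup)
  have upper: "K \<le> Sup ?A" if "curvature_dimension_ineq E x K N" for K
    using that bdd' by (intro cSup_upper) auto
  have "curvature_function E x N = Sup ?A"
    unfolding curvature_function_def using Sup upper by (intro Greatest_equality) auto
  then show "curvature_dimension_ineq E x (curvature_function E x N) N"
    and "K\<^sub>0 \<le> curvature_function E x N" using Sup upper mem by auto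
qed

text \<open>The bound on each summand is the tangent line of \<open>1 / (t + s)\<close> at \<open>s = 0\<close>, shifted up by
  \<open>\<epsilon> / t\<^sup>2\<close>, so that the terms linear in \<open>b\<close> cancel.\<close>

lemma sum_inverse_shift_le:
  fixes b :: "'a \<Rightarrow> real"
  assumes t: "t > 0" and sum0: "sum b A = 0"
    and pos: "\<And>i. i \<in> A \<Longrightarrow> t + \<epsilon> + b i > 0"
    and le: "\<And>i. i \<in> A \<Longrightarrow> b i * (\<epsilon> + b i) \<le> \<epsilon> * t"
  shows "(\<Sum>i\<in>A. 1 / (t + \<epsilon> + b i)) \<le> real (card A) / t"
proof -
  have "(\<Sum>i\<in>A. 1 / (t + \<epsilon> + b i)) \<le> (\<Sum>i\<in>A. 1 / t - b i * (1 / t\<^sup>2))"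
  proof (rule sum_mono)
    fix i assume i: "i \<in> A"
    have "t\<^sup>2 \<le> (t - b i) * (t + \<epsilon> + b i)"
      using le[OF i] by (simp add: algebra_simps power2_eq_square)
    then have "1 / (t + \<epsilon> + b i) \<le> (t - b i) / t\<^sup>2"
      using t pos[OF i] by (simp add: divide_simps)
    also have "\<dots> = 1 / t - b i * (1 / t\<^sup>2)" using t by (simp add: power2_eq_square field_simps)
    finally show "1 / (t + \<epsilon> + b i) \<le> 1 / t - b i * (1 / t\<^sup>2)" .
  qed
  also have "\<dots> = real (card A) / t" by (simp only: sum_subtractf sum_distrib_right[symmetric] sum0) simp
  finally show ?thesis .
qed

theorem corollary5p6:
  fixes V :: "'a set" and E :: "'a set set" and x :: 'a
  assumes "locally_finite_simple_graph V E"
    and "x \<in> V"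
    and "vertex_degree E x \<ge> 1"
  shows "\<exists>L :: real.
      ((\<lambda>N :: real. curvature_function E x (ereal N) + 2 * real (vertex_degree E x) / N) \<longlongrightarrow> L) (at_right 0) \<and>
      av_out_degree E x = 3 + real (vertex_degree E x) - 2 * L"
proof -
  interpret locally_finite_simple_graph V E by fact
  let ?N = "neighbours E x"
  define d where "d = real (vertex_degree E x)"
  \<comment> \<open>\<open>L\<close> is the mean of \<open>a\<close> over the neighbours plus
    \<open>d\<close>, so \<open>b\<close> below is the deviation of \<open>a\<close> from its
    mean.\<close>
  define L where "L = (3 + d - av_out_degree E x) / 2"
  define a where "a = (\<lambda>y. (3 - real (out_degree E x y) - d) / 2)"
  define b where "b = (\<lambda>y. a y - (L - d))"
  have dpos: "d > 0" using assms(3) by (simp add: d_def)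
  have sum0: "sum b ?N = 0"
    using dpos by (simp add: b_def a_def L_def sum_subtractf sum_divide_distrib[symmetric]
        av_out_degree_def d_def vertex_degree_def field_simps sum_distrib_left)
  have t_lim: "filterlim (\<lambda>N. d * (2 / N - 1)) at_top (at_right 0)"
  proof -
    have "filterlim (\<lambda>N::real. - d + 2 * d * inverse N) at_top (at_right 0)"
      using dpos by (intro filterlim_tendsto_add_at_top[OF tendsto_const]
          filterlim_tendsto_pos_mult_at_top[OF tendsto_const] filterlim_inverse_at_top_right) auto
    then show ?thesis by (simp add: field_simps)
  qed
  have upper: "K + 2 * d / N \<le> L" if "N > 0" "curvature_dimension_ineq E x K (ereal N)" for K N
    using curvature_dimension_ineq_upper[OF that(1) assms(3) that(2)] by (simp add: L_def d_def)
  have ev: "\<forall>\<^sub>F N in at_right 0. L - \<epsilon> \<le> curvature_function E x (ereal N) + 2 * d / N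
      \<and> curvature_function E x (ereal N) + 2 * d / N \<le> L" if \<epsilon>: "\<epsilon> > 0" for \<epsilon>
  proof -
    \<comment> \<open>The two conditions required by \<open>sum_inverse_shift_le\<close>, the second
      divided by \<epsilon>; they hold for all neighbours at once because there are finitely
      many.\<close>
    have "\<forall>\<^sub>F N in at_right 0. \<forall>y\<in>?N. d * (2 / N - 1) > - \<epsilon> - b y
        \<and> d * (2 / N - 1) \<ge> b y * (\<epsilon> + b y) / \<epsilon>"
      using t_lim[unfolded filterlim_at_top] t_lim[unfolded filterlim_at_top_dense]
      by (intro eventually_ball_finite finite_neighbours ballI eventually_conj) auto
    moreover have "\<forall>\<^sub>F N in at_right (0::real). 0 < N \<and> N < 2"
      using eventually_at_right[of 0 "1::real"] by (auto intro!: exI[of _ 2])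
    ultimately show ?thesis
    proof eventually_elim
      case (elim N)
      define t where "t = d * (2 / N - 1)"
      \<comment> \<open>The candidate falls short of the upper bound by \<epsilon>; this slack
        absorbs the second-order error in \<open>b\<close>.\<close>
      define K where "K = L - \<epsilon> - 2 * d / N"
      have t: "t > 0" using elim dpos by (simp add: t_def field_simps)
      have aK: "a y - K = t + \<epsilon> + b y" for y
        by (simp add: t_def K_def b_def algebra_simps)
      have pos: "t + \<epsilon> + b y > 0" if "y \<in> ?N" for y
        using elim that by (force simp: t_def)
      have le: "b y * (\<epsilon> + b y) \<le> \<epsilon> * t" if "y \<in> ?N" for y
      proof -
        have "b y * (\<epsilon> + b y) / \<epsilon> \<le> t" using elim that by (simp add: t_def)
        then show ?thesis using \<epsilon> by (simp add: pos_divide_le_eq mult.commute)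
      qed
      \<comment> \<open>By the choice of \<open>t\<close>, the factor \<open>2 / N - 1\<close>
        equals \<open>t / d\<close>, so the estimate ends at exactly 1.\<close>
      have "(2 / N - 1) * (\<Sum>y\<in>?N. 1 / (a y - K)) \<le> (2 / N - 1) * (d / t)"
        using sum_inverse_shift_le[OF t sum0 pos le] elim
        by (intro mult_left_mono) (auto simp: aK d_def vertex_degree_def)
      also have "\<dots> = 1" using t dpos by (auto simp: t_def)
      finally have "(2 / N - 1) * (\<Sum>y\<in>?N. 1 / (a y - K)) \<le> 1" .
      moreover have "K < a y" if "y \<in> ?N" for y using pos[OF that] aK[of y] by linarith
      ultimately have "curvature_dimension_ineq E x K (ereal N)"
        using elim unfolding a_def d_def by (intro curvature_dimension_ineq_if) auto
      moreover have "K' \<le> L - 2 * d / N" if "curvature_dimension_ineq E x K' (ereal N)" for K'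
        using upper[OF _ that] elim by simp
      \<comment> \<open>The maximum is attained, so \<open>upper\<close> applies to the curvature
        function itself.\<close>
      ultimately have "K \<le> curvature_function E x (ereal N)"
        and "curvature_dimension_ineq E x (curvature_function E x (ereal N)) (ereal N)"
        by (auto intro: curvature_function_greatest)
      then show ?case using upper elim by (auto simp: K_def)
    qed
  qed
  have "((\<lambda>N. curvature_function E x (ereal N) + 2 * d / N) \<longlongrightarrow> L) (at_right 0)"
  proof (rule tendstoI)
    fix e :: real assume e: "e > 0"
    show "\<forall>\<^sub>F N in at_right 0. dist (curvature_function E x (ereal N) + 2 * d / N) L < e"
      \<comment> \<open>\<open>ev\<close> is non-strict, hence half of \<open>e\<close>.\<close>
      using ev[OF half_gt_zero[OF e]] by eventually_elim (use e in \<open>auto simp: dist_real_def\<close>)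
  qed
  then show ?thesis by (intro exI[of _ L]) (simp add: L_def d_def field_simps)
qed

end
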